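(* Let $A,B,H,K$ be any logically independent events. Given a coherent assessment $(x,y)$ on $\{A|H,B|K\}$, with $x\neq 0$, for the iterated conditional $(B|K)|_{S}(A|H)$ the extension $\mu_S=\mathbb{P}((B|K)|_{S}(A|H))$ is coherent if and only if $\mu_S\in[\mu_S',\mu_S'']$, where $$\mu_S'=\max\left\{\frac{x+y-1}{x},0\right\},\qquad \mu_S''=\begin{cases}\frac{x+y-2xy}{x(1-xy)}, & \text{if } (x,y)\neq(1,1),\\ 1, & \text{if } (x,y)=(1,1).\end{cases}$$
   Context: Events are two-valued entities identified with their indicators (values $1/0$); $\emptyset$ is the impossible event, $AB=A\wedge B$, $\overline{A}$ is the negation. Four events are logically independent if all $16$ conjunctions obtained by taking each event or its negation are different from $\emptyset$. For $H\neq\emptyset$ the conditional event $E|H$ is true if $EH$ is true, false if $\overline{E}H$ is true, void if $\overline{H}$ is true. Once $P(E|H)=p$ is assessed, $E|H$ is also the random quantity $EH+p\overline{H}$; numerically $\overline{A}|H=1-A|H$. Sobocinski (quasi) conjunction (a conditional event): $(A|H)\wedge_S(B|K)=((AH\vee\overline{H})\wedge(BK\vee\overline{K}))|(H\vee K)$. Iterated conditional: $(B|K)|_S(A|H)$ is the random quantity $(A|H)\wedge_S(B|K)+\mu_S\,(\overline{A}|H)$, where $\mu_S$ is its assessed prevision (the amount paid to receive it), the right-hand side being computed numerically from $x=P(A|H)$, $z=P[(A|H)\wedge_S(B|K)]$ and $\mu_S$. Also $y=P(B|K)$. Coherence: an assessment of real values $m_j$ on a finite family of such objects $X_j$ (conditional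 events, as random quantities, and iterated conditionals) is coherent iff for every nonempty subfamily $J$ and all reals $s_j$, the random gain $\sum_{j\in J}s_j(X_j-m_j)$, restricted to the cases where at least one of the bets in $J$ is not called off, has minimum $\le 0$ and maximum $\ge 0$. A bet on a conditional event is called off when it is void; a bet on the iterated conditional is called off in the cases where one receives back the paid amount $\mu_S$ whatever it is (taking into account the relation $z=x\mu_S$ required by linearity of coherent previsions). The value $\mu_S$ is a coherent extension of $(x,y)$ iff there is $z$ such that $(x,y,z,\mu_S)$ is coherent on $\{A|H,B|K,(A|H)\wedge_S(B|K),(B|K)|_S(A|H)\}$. *)

theory Defs
  imports Complex_Main "HOL-Library.Indicator_Function"
begin

(* Events are subsets of an arbitrary possibility space 'w. *)

definition logically_independent ::
  "'w set \<Rightarrow> 'w set \<Rightarrow> 'w set \<Rightarrow> 'w set \<Rightarrow> bool" where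
  "logically_independent A B H K \<longleftrightarrow>
     (\<forall>A'\<in>{A, - A}. \<forall>B'\<in>{B, - B}. \<forall>H'\<in>{H, - H}. \<forall>K'\<in>{K, - K}.
        A' \<inter> B' \<inter> H' \<inter> K' \<noteq> {})"

(* Cond E H is the conditional event E|H. The requirement that H be possible is not part of
   the type; it holds for H, K and H \<union> K whenever A, B, H, K are logically independent. *)
datatype 'w cond_event = Cond (event: "'w set") (given: "'w set")

definition void :: "'w cond_event \<Rightarrow> 'w set" where
  "void C = - given C"

definition cond_neg :: "'w cond_event \<Rightarrow> 'w cond_event" where
  "cond_neg C = Cond (- event C) (given C)"

(* The random quantity EH + p(1 - H) attached to E|H once P(E|H) = p is assessed. *)
definition cond_value :: "real \<Rightarrow> 'w cond_event \<Rightarrow> 'w \<Rightarrow> real" where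
  "cond_value p C w = indicator (event C \<inter> given C) w + p * indicator (- given C) w"

lemma cond_value_neg: "cond_value (1 - p) (cond_neg C) w = 1 - cond_value p C w"
  by (cases C) (simp add: cond_value_def cond_neg_def indicator_def)

definition sobocinski_conj :: "'w cond_event \<Rightarrow> 'w cond_event \<Rightarrow> 'w cond_event"
    (infixr "\<and>\<^sub>S" 70) where
  "C \<and>\<^sub>S D =
     Cond (((event C \<inter> given C) \<union> - given C) \<inter> ((event D \<inter> given D) \<union> - given D))
          (given C \<union> given D)"

(* Value of the iterated conditional D |_S C, i.e. (C \<and>_S D) + m (not C), where
   x = P(C), z = P(C \<and>_S D) and m is the prevision of D |_S C itself. *)
definition iter_value ::
  "real \<Rightarrow> real \<Rightarrow> real \<Rightarrow> 'w cond_event \<Rightarrow> 'w cond_event \<Rightarrow> 'w \<Rightarrow> real" where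
  "iter_value x z m D C w =
     cond_value z (C \<and>\<^sub>S D) w + m * cond_value (1 - x) (cond_neg C) w"

(* The cases where the paid amount m is received back whatever m is; here z is replaced by
   x * m, the value forced by linearity of coherent previsions. *)
definition iter_called_off ::
  "real \<Rightarrow> 'w cond_event \<Rightarrow> 'w cond_event \<Rightarrow> 'w set" where
  "iter_called_off x D C = {w. \<forall>m. iter_value x (x * m) m D C w = m}"

lemma iter_called_off_Cond:
  assumes "x \<noteq> 0"
  shows "iter_called_off x (Cond B K) (Cond A H) = (- A \<inter> H) \<union> (- H \<inter> - K)"
proof -
  have "(\<forall>m. iter_value x (x * m) m (Cond B K) (Cond A H) w = m) \<longleftrightarrow>
        w \<in> (- A \<inter> H) \<union> (- H \<inter> - K)" for w
    using assms
    by (auto simp: iter_value_def cond_value_def cond_neg_def sobocinski_conj_def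
          indicator_def algebra_simps intro: exI[of _ 0] dest: spec[of _ 0] spec[of _ 1])
  then show ?thesis
    by (auto simp: iter_called_off_def)
qed

datatype 'w bet = Bet (quantity: "'w \<Rightarrow> real") (price: real) (called_off: "'w set")

definition cond_bet :: "'w cond_event \<Rightarrow> real \<Rightarrow> 'w bet" where
  "cond_bet C p = Bet (cond_value p C) p (void C)"

definition iter_bet ::
  "real \<Rightarrow> real \<Rightarrow> 'w cond_event \<Rightarrow> 'w cond_event \<Rightarrow> real \<Rightarrow> 'w bet" where
  "iter_bet x z D C m = Bet (iter_value x z m D C) m (iter_called_off x D C)"

definition gain :: "'w bet list \<Rightarrow> nat set \<Rightarrow> (nat \<Rightarrow> real) \<Rightarrow> 'w \<Rightarrow> real" where
  "gain bs J s w = (\<Sum>j\<in>J. s j * (quantity (bs ! j) w - price (bs ! j)))"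

definition active :: "'w bet list \<Rightarrow> nat set \<Rightarrow> 'w set" where
  "active bs J = (\<Union>j\<in>J. - called_off (bs ! j))"

(* The quantities considered take finitely many values, so the minimum and maximum are taken
   over finite sets (see finite_gain below), even if 'w is infinite. *)
definition coherent :: "'w bet list \<Rightarrow> bool" where
  "coherent bs \<longleftrightarrow>
     (\<forall>J s. J \<subseteq> {..<length bs} \<and> J \<noteq> {} \<longrightarrow>
        Min (gain bs J s ` active bs J) \<le> 0 \<and> Max (gain bs J s ` active bs J) \<ge> 0)"

lemma finite_range_cond_value: "finite (range (cond_value p C))"
proof (rule finite_subset)
  show "range (cond_value p C) \<subseteq> {0, 1, p}"
    by (auto simp: cond_value_def indicator_def)
qed simp

lemma finite_range_iter_value: "finite (range (iter_value x z m D C))"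
proof (rule finite_subset)
  show "range (iter_value x z m D C) \<subseteq>
    (\<lambda>(u, v). u + m * v) `
      (range (cond_value z (C \<and>\<^sub>S D)) \<times> range (cond_value (1 - x) (cond_neg C)))"
    by (auto simp: iter_value_def)
qed (simp add: finite_range_cond_value)

lemma finite_gain:
  assumes "J \<subseteq> {..<length bs}" and "\<And>b. b \<in> set bs \<Longrightarrow> finite (range (quantity b))"
  shows "finite (gain bs J s ` W)"
proof -
  have "finite J" using assms(1) finite_subset by blast
  moreover have "finite (range (quantity (bs ! j)))" if "j \<in> J" for j
    using assms that by (auto intro!: assms(2) nth_mem)
  ultimately have "finite (range (gain bs J s))"
  proof (induction J rule: finite_induct)
    case empty
    have "range (gain bs {} s) \<subseteq> {0}" by (auto simp: gain_def)
    then show ?case by (rule finite_subset) simp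
  next
    case (insert i J)
    have "range (gain bs (insert i J) s) \<subseteq>
      (\<lambda>(q, g). s i * (q - price (bs ! i)) + g) `
        (range (quantity (bs ! i)) \<times> range (gain bs J s))"
      using insert.hyps by (auto simp: gain_def)
    moreover have "finite (range (quantity (bs ! i)) \<times> range (gain bs J s))"
      using insert by simp
    ultimately show ?case by (meson finite_imageI finite_subset)
  qed
  then show ?thesis by (rule finite_subset[rotated]) auto
qed

(* m is a coherent extension to D |_S C of the assessment P(C) = x, P(D) = y. *)
definition coherent_extension ::
  "'w cond_event \<Rightarrow> 'w cond_event \<Rightarrow> real \<Rightarrow> real \<Rightarrow> real \<Rightarrow> bool" where
  "coherent_extension C D x y m \<longleftrightarrow>
     (\<exists>z. coherent [cond_bet C x, cond_bet D y, cond_bet (C \<and>\<^sub>S D) z, iter_bet x z D C m])"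

end

theory Submission
  imports Defs
begin

text \<open>
  Write \<open>X\<close>, \<open>Y\<close>, \<open>Z\<close> for the random quantities of \<open>A|H\<close>, \<open>B|K\<close> and their Sobocinski conjunction,
  priced at \<open>x\<close>, \<open>y\<close>, \<open>z\<close>. The iterated conditional is \<open>Z + m (1 - X)\<close>, so a unit bet on it gains
  \<open>(Z - z) - m (X - x) + (z - x m)\<close>: up to a constant it is a combination of bets on \<open>Z\<close> and \<open>X\<close>
  (\<open>iter_value_diff\<close>). A bettor can isolate that constant, so coherence forces \<open>z = x m\<close>, and after
  that every gain is of the form \<open>\<alpha> (X - x) + \<beta> (Y - y) + \<gamma> (Z - z)\<close>. The question becomes which \<open>z\<close>
  are coherent for the conjunction, and the interval for \<open>m\<close> is the interval for \<open>z\<close> divided by \<open>x\<close>.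

  The bounds on \<open>z\<close> are necessary because \<open>0 \<le> Z \<le> 1\<close>, \<open>X + Y - 1 \<le> Z\<close> and
  \<open>(1 - x y) Z \<le> (1 - y) X + (1 - x) Y\<close> hold in every case in which \<open>H\<close> or \<open>K\<close> is true
  (\<open>sobocinski_conj_lower\<close>, \<open>sobocinski_conj_upper\<close>); a price that violates one of them gives a sure loss
  (\<open>coherent_iter_price_bounds\<close>).

  They are sufficient because both ends are expectations. Let \<open>l = max (x + y - 1) 0\<close>. The weights
  \<open>l\<close>, \<open>x - l\<close>, \<open>y - l\<close>, \<open>1 - x - y + l\<close> on the four cases with \<open>H\<close> and \<open>K\<close> true (according to
  the truth of \<open>A\<close> and \<open>B\<close>) give \<open>X\<close>, \<open>Y\<close>, \<open>Z\<close> the means \<open>x\<close>, \<open>y\<close>, \<open>l\<close>. The weights \<open>x (1 - y)\<close> on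
  \<open>A H\<close> with \<open>K\<close> false, \<open>y (1 - x)\<close> on \<open>B K\<close> with \<open>H\<close> false and \<open>(1 - x) (1 - y)\<close> on \<open>H K\<close> with
  \<open>A\<close> and \<open>B\<close> false have total \<open>1 - x y\<close>; if this is positive, normalising them
  gives the means \<open>x\<close>, \<open>y\<close> and the upper end for \<open>z\<close>. The two weighted sums of a gain are therefore
  nonnegative multiples of \<open>\<gamma> (l - z)\<close> and of \<open>\<gamma>\<close> times the distance of \<open>z\<close> from the upper
  end. If \<open>x = y = 1\<close>, the two ends coincide and the first sum is zero. In general,
  negativity of the gain wherever some bet stands makes the first sum negative, hence \<open>\<gamma> > 0\<close>, and then also the second, which \<open>\<gamma> > 0\<close> excludes
  (\<open>coherent_iter_betsI\<close>).
\<close>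

section \<open>Coherence by gains\<close>

lemma gain_uminus: "gain bs J (\<lambda>j. - s j) w = - gain bs J s w"
  by (simp add: gain_def sum_negf)

text \<open>
  Replacing the stakes by their negatives exchanges minimum and maximum, so it is enough to exclude
  that all gains are negative. If every bet can stand and every quantity has finite
  range, then the minimum and maximum are those of finite nonempty sets.
\<close>
lemma coherent_iff_no_sure_loss:
  assumes finite: "\<And>b. b \<in> set bs \<Longrightarrow> finite (range (quantity b))"
    and possible: "\<And>b. b \<in> set bs \<Longrightarrow> called_off b \<noteq> UNIV"
  shows "coherent bs \<longleftrightarrow>
    (\<forall>J s. J \<subseteq> {..<length bs} \<and> J \<noteq> {} \<longrightarrow> (\<exists>w\<in>active bs J. 0 \<le> gain bs J s w))"
proof -
  have ends: "Min (gain bs J s ` active bs J) \<le> 0 \<longleftrightarrow> (\<exists>w\<in>active bs J. gain bs J s w \<le> 0)"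
    "Max (gain bs J s ` active bs J) \<ge> 0 \<longleftrightarrow> (\<exists>w\<in>active bs J. 0 \<le> gain bs J s w)"
    if J: "J \<subseteq> {..<length bs}" "J \<noteq> {}" for J s
  proof -
    from J obtain j where "j \<in> J" "bs ! j \<in> set bs"
      by (metis ex_in_conv lessThan_iff nth_mem subsetD)
    then have "active bs J \<noteq> {}"
      using possible[of "bs ! j"] by (auto simp: active_def)
    moreover have "finite (gain bs J s ` active bs J)"
      using finite_gain[OF J(1) finite] .
    ultimately show "Min (gain bs J s ` active bs J) \<le> 0 \<longleftrightarrow> (\<exists>w\<in>active bs J. gain bs J s w \<le> 0)"
      and "Max (gain bs J s ` active bs J) \<ge> 0 \<longleftrightarrow> (\<exists>w\<in>active bs J. 0 \<le> gain bs J s w)"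
      by (simp_all add: Min_le_iff Max_ge_iff)
  qed
  show ?thesis
  proof
    assume "coherent bs"
    then show "\<forall>J s. J \<subseteq> {..<length bs} \<and> J \<noteq> {} \<longrightarrow> (\<exists>w\<in>active bs J. 0 \<le> gain bs J s w)"
      using ends by (simp add: coherent_def)
  next
    assume R: "\<forall>J s. J \<subseteq> {..<length bs} \<and> J \<noteq> {} \<longrightarrow> (\<exists>w\<in>active bs J. 0 \<le> gain bs J s w)"
    show "coherent bs"
      unfolding coherent_def
    proof (intro allI impI)
      fix J s
      assume J: "J \<subseteq> {..<length bs} \<and> J \<noteq> {}"
      then have "\<exists>w\<in>active bs J. 0 \<le> gain bs J (\<lambda>j. - s j) w"
        using R by blast
      then show "Min (gain bs J s ` active bs J) \<le> 0 \<and> Max (gain bs J s ` active bs J) \<ge> 0"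
        using J R ends by (simp add: gain_uminus)
    qed
  qed
qed

lemma coherent_cond_bet_price:
  assumes coh: "coherent bs"
    and finite: "\<And>b. b \<in> set bs \<Longrightarrow> finite (range (quantity b))"
    and possible: "\<And>b. b \<in> set bs \<Longrightarrow> called_off b \<noteq> UNIV"
    and bet: "cond_bet C p \<in> set bs"
  shows "0 \<le> p \<and> p \<le> 1"
proof -
  from bet obtain j where j: "j < length bs" "bs ! j = cond_bet C p"
    by (auto simp: in_set_conv_nth)
  have act: "\<exists>w\<in>given C. 0 \<le> t * (indicator (event C) w - p)" for t :: real
  proof -
    have "\<exists>w\<in>active bs {j}. 0 \<le> gain bs {j} (\<lambda>_. t) w"
      using coherent_iff_no_sure_loss[of bs, OF finite possible] coh j by blast
    then show ?thesis
      by (auto simp: active_def gain_def j cond_bet_def void_def cond_value_def indicator_inter_arith)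
  qed
  from act[of 1] act[of "-1"] show ?thesis
    by (auto simp: indicator_def of_bool_def split: if_splits)
qed

section \<open>The Sobocinski conjunction and the iterated conditional\<close>

lemma iter_value_diff:
  "iter_value x z m D C w - m =
     (cond_value z (C \<and>\<^sub>S D) w - z) - m * (cond_value x C w - x) + (z - x * m)"
  by (simp add: iter_value_def cond_value_neg algebra_simps)

text \<open>
  Together with \<open>0 \<le> Z \<le> 1\<close>, this inequality and the next give the supporting planes, below and above
  \<open>(x, y)\<close>, of the set of possible values \<open>(X, Y, Z)\<close>. The plane of the next one goes through the values
  \<open>(1, y, 1)\<close>, \<open>(x, 1, 1)\<close> and \<open>(0, 0, 0)\<close>, taken when only one of the two conditional events is
  void and the other is true, and when both are false.
\<close>
lemma sobocinski_conj_lower: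
  assumes "x \<le> 1" "y \<le> 1" "w \<in> given C \<union> given D"
  shows "cond_value x C w + cond_value y D w - 1 \<le> cond_value z (C \<and>\<^sub>S D) w"
  using assms by (auto simp: cond_value_def sobocinski_conj_def indicator_def)

lemma sobocinski_conj_upper:
  assumes "0 \<le> x" "x \<le> 1" "0 \<le> y" "y \<le> 1" "w \<in> given C \<union> given D"
  shows "(1 - x * y) * cond_value z (C \<and>\<^sub>S D) w
    \<le> (1 - y) * cond_value x C w + (1 - x) * cond_value y D w"
proof -
  have "0 \<le> (1 - x) * (1 - y)" "0 \<le> (1 - y) * x" "0 \<le> (1 - x) * y"
    using assms by simp_all
  then show ?thesis
    using assms by (auto simp: cond_value_def sobocinski_conj_def indicator_def algebra_simps)
qed

section \<open>The coherent prices\<close>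

abbreviation iter_bets ::
  "'w cond_event \<Rightarrow> 'w cond_event \<Rightarrow> real \<Rightarrow> real \<Rightarrow> real \<Rightarrow> real \<Rightarrow> 'w bet list" where
  "iter_bets C D x y z m \<equiv>
     [cond_bet C x, cond_bet D y, cond_bet (C \<and>\<^sub>S D) z, iter_bet x z D C m]"

lemma lessThan_4: "{..<4} = {0, 1, 2, 3::nat}"
  by auto

lemma finite_range_iter_bets:
  "b \<in> set (iter_bets C D x y z m) \<Longrightarrow> finite (range (quantity b))"
  by (auto simp: cond_bet_def iter_bet_def finite_range_cond_value finite_range_iter_value)

lemma called_off_iter_bets_ne_UNIV:
  assumes "logically_independent A B H K" "x \<noteq> 0"
    and b: "b \<in> set (iter_bets (Cond A H) (Cond B K) x y z m)"
  shows "called_off b \<noteq> UNIV"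
proof -
  have "A \<inter> B \<inter> H \<inter> K \<noteq> {}"
    using assms(1) by (auto simp: logically_independent_def)
  then show ?thesis
    using b by (auto simp: cond_bet_def iter_bet_def void_def sobocinski_conj_def
        iter_called_off_Cond[OF assms(2)])
qed

lemma coherent_iter_price_bounds:
  assumes indep: "logically_independent A B H K" and "x \<noteq> 0"
    and coh: "coherent (iter_bets (Cond A H) (Cond B K) x y z m)"
  shows "z = x * m" "max (x + y - 1) 0 \<le> z" "z \<le> 1" "z * (1 - x * y) \<le> x + y - 2 * x * y"
proof -
  let ?C = "Cond A H" and ?D = "Cond B K"
  let ?bs = "iter_bets ?C ?D x y z m"
  have len: "length ?bs = 4" by simp
  note finite = finite_range_iter_bets[where C = ?C and D = ?D and x = x and y = y and z = z and m = m]
  note possible = called_off_iter_bets_ne_UNIV[OF indep \<open>x \<noteq> 0\<close>, where y = y and z = z and m = m]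
  have no_loss: "\<exists>w\<in>active ?bs J. 0 \<le> gain ?bs J s w" if "J \<subseteq> {..<4}" "J \<noteq> {}" for J s
    using coh coherent_iff_no_sure_loss[of ?bs, OF finite possible] that unfolding len by blast
  have price: "0 \<le> p \<and> p \<le> 1" if "cond_bet E p \<in> set ?bs" for E p
    using coherent_cond_bet_price[OF coh finite possible that] .
  have x: "0 \<le> x" "x \<le> 1" and y: "0 \<le> y" "y \<le> 1" and z: "0 \<le> z" "z \<le> 1"
    using price[of ?C x] price[of ?D y] price[of "?C \<and>\<^sub>S ?D" z] by auto
  show "z \<le> 1" by (rule z)
  \<comment> \<open>These stakes cancel every random part of the iterated conditional. What remains is the
    same in all cases, whatever \<open>t\<close> is.\<close>
  have "0 \<le> t * (z - x * m)" for t
  proof -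
    have "\<exists>w. 0 \<le> gain ?bs {0, 2, 3} (\<lambda>j. if j = 0 then t * m else if j = 2 then - t else t) w"
      using no_loss[of "{0, 2, 3}"] by fastforce
    moreover have "gain ?bs {0, 2, 3} (\<lambda>j. if j = 0 then t * m else if j = 2 then - t else t) w
        = t * (z - x * m)" for w
      by (simp add: gain_def cond_bet_def iter_bet_def iter_value_diff) (simp add: algebra_simps)
    ultimately show ?thesis by simp
  qed
  from this[of 1] this[of "-1"] show "z = x * m" by simp
  have three: "\<exists>w\<in>H \<union> K. 0 \<le> a * (cond_value x ?C w - x) + b * (cond_value y ?D w - y)
      + c * (cond_value z (?C \<and>\<^sub>S ?D) w - z)" for a b c
    using no_loss[of "{0, 1, 2}" "\<lambda>j. if j = 0 then a else if j = 1 then b else c"]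
    by (fastforce simp: gain_def active_def cond_bet_def void_def sobocinski_conj_def algebra_simps)
  from three[of 1 1 "-1"] obtain w where "w \<in> H \<union> K"
    and w: "0 \<le> 1 * (cond_value x ?C w - x) + 1 * (cond_value y ?D w - y)
      + - 1 * (cond_value z (?C \<and>\<^sub>S ?D) w - z)"
    by blast
  then have "x + y - 1 \<le> z"
    using sobocinski_conj_lower[of x y w ?C ?D z] x y by simp
  then show "max (x + y - 1) 0 \<le> z"
    using z by simp
  from three[of "- (1 - y)" "- (1 - x)" "1 - x * y"] obtain w where "w \<in> H \<union> K"
    and w: "0 \<le> - (1 - y) * (cond_value x ?C w - x) + - (1 - x) * (cond_value y ?D w - y)
      + (1 - x * y) * (cond_value z (?C \<and>\<^sub>S ?D) w - z)"
    by blast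
  then show "z * (1 - x * y) \<le> x + y - 2 * x * y"
    using sobocinski_conj_upper[of x y w ?C ?D z] x y by (simp add: algebra_simps)
qed

text \<open>
  A cancelled bet returns its price, so that outside the active cases the gain is exactly zero. This
  lets weighted sums run over all cases and not only over the active ones.
\<close>
lemma gain_called_off:
  assumes "w \<notin> active bs J"
    and "\<And>j. j \<in> J \<Longrightarrow> w \<in> called_off (bs ! j) \<Longrightarrow> quantity (bs ! j) w = price (bs ! j)"
  shows "gain bs J s w = 0"
  using assms by (auto simp: gain_def active_def intro!: sum.neutral)

lemma called_off_iter_bets_quantity:
  assumes "z = x * m" "j < 4" "w \<in> called_off (iter_bets C D x y z m ! j)"
  shows "quantity (iter_bets C D x y z m ! j) w = price (iter_bets C D x y z m ! j)"
proof -
  have "j = 0 \<or> j = 1 \<or> j = 2 \<or> j = 3"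
    using assms(2) by auto
  then show ?thesis
    using assms(1,3)
    by (elim disjE) (simp_all add: cond_bet_def iter_bet_def void_def cond_value_def iter_called_off_def)
qed

text \<open>
  The coefficients are \<open>\<alpha> = s\<^sub>0 - m s\<^sub>3\<close>, \<open>\<beta> = s\<^sub>1\<close>, \<open>\<gamma> = s\<^sub>2 + s\<^sub>3\<close>, where a stake outside \<open>J\<close> counts as
  zero. The clause on \<open>\<gamma>\<close> matters because bets 2 and 3 both stand when one of the
  conditional events is true and the other void, whereas bet 0 or 1 alone may be called off there.
\<close>
lemma gain_iter_bets:
  assumes z: "z = x * m" and J: "J \<subseteq> {..<4}"
  shows "\<exists>\<alpha> \<beta> \<gamma>. (\<gamma> \<noteq> 0 \<longrightarrow> J \<inter> {2, 3} \<noteq> {}) \<and>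
    (\<forall>w. gain (iter_bets C D x y z m) J s w = \<alpha> * (cond_value x C w - x)
       + \<beta> * (cond_value y D w - y) + \<gamma> * (cond_value z (C \<and>\<^sub>S D) w - z))"
proof -
  let ?bs = "iter_bets C D x y z m"
  define t where "t j = (if j \<in> J then s j else 0)" for j
  have "gain ?bs J s w = gain ?bs {..<4} t w" for w
    unfolding gain_def t_def using J
    by (intro sum.mono_neutral_cong_left) auto
  then have "gain ?bs J s w = (t 0 - m * t 3) * (cond_value x C w - x)
       + t 1 * (cond_value y D w - y) + (t 2 + t 3) * (cond_value z (C \<and>\<^sub>S D) w - z)" for w
    unfolding gain_def lessThan_4
    by (simp add: cond_bet_def iter_bet_def iter_value_diff z[symmetric]) (simp add: algebra_simps)
  moreover have "t 2 + t 3 \<noteq> 0 \<longrightarrow> J \<inter> {2, 3} \<noteq> {}"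
    by (auto simp: t_def)
  ultimately show ?thesis by blast
qed

text \<open>
  The two systems of weights described at the beginning are tested against a gain that is negative in
  all active cases. The weights are concentrated enough on active cases to make the sums
  strictly negative: the cases \<open>A H K\<close> are active for every bet and carry the weight \<open>x > 0\<close>; once
  \<open>\<gamma> \<noteq> 0\<close>, the cases where one conditional event is true and the other void are active, and their
  weight is positive unless \<open>x = y = 1\<close>, where only \<open>z = 1\<close> lies between the bounds.
\<close>
lemma coherent_iter_betsI:
  assumes indep: "logically_independent A B H K"
    and x: "0 < x" "x \<le> 1" and y: "0 \<le> y" "y \<le> 1"
    and z: "z = x * m" and lower: "max (x + y - 1) 0 \<le> z"
    and upper: "z \<le> 1" "z * (1 - x * y) \<le> x + y - 2 * x * y"
  shows "coherent (iter_bets (Cond A H) (Cond B K) x y z m)"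
proof -
  let ?C = "Cond A H" and ?D = "Cond B K"
  let ?bs = "iter_bets ?C ?D x y z m"
  have len: "length ?bs = 4" by simp
  have "x \<noteq> 0" using x by simp
  note finite = finite_range_iter_bets[where C = ?C and D = ?D and x = x and y = y and z = z and m = m]
  note possible = called_off_iter_bets_ne_UNIV[OF indep \<open>x \<noteq> 0\<close>, where y = y and z = z and m = m]
  \<comment> \<open>The letters give the status of \<open>A|H\<close> and then of \<open>B|K\<close>: true, false or void.\<close>
  from indep obtain tt tf ft ff tv vt where
    atoms: "tt \<in> A \<inter> B \<inter> H \<inter> K" "tf \<in> A \<inter> - B \<inter> H \<inter> K" "ft \<in> - A \<inter> B \<inter> H \<inter> K"
      "ff \<in> - A \<inter> - B \<inter> H \<inter> K" "tv \<in> A \<inter> B \<inter> H \<inter> - K" "vt \<in> A \<inter> B \<inter> - H \<inter> K"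
    unfolding logically_independent_def by (metis ex_in_conv insertCI)
  have "\<exists>w\<in>active ?bs J. 0 \<le> gain ?bs J s w" if J: "J \<subseteq> {..<4}" "J \<noteq> {}" for J s
  proof (rule ccontr)
    assume "\<not> ?thesis"
    then have neg: "gain ?bs J s w < 0" if "w \<in> active ?bs J" for w
      using that by force
    have nonpos: "gain ?bs J s w \<le> 0" for w
    proof (cases "w \<in> active ?bs J")
      case True
      then show ?thesis using neg[of w] by simp
    next
      case False
      have "gain ?bs J s w = 0"
        by (rule gain_called_off[OF False], rule called_off_iter_bets_quantity[OF z]) (use J in auto)
      then show ?thesis by simp
    qed
    obtain \<alpha> \<beta> \<gamma> where \<gamma>: "\<gamma> \<noteq> 0 \<Longrightarrow> J \<inter> {2, 3} \<noteq> {}"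
      and gain: "\<And>w. gain ?bs J s w = \<alpha> * (cond_value x ?C w - x)
         + \<beta> * (cond_value y ?D w - y) + \<gamma> * (cond_value z (?C \<and>\<^sub>S ?D) w - z)"
      using gain_iter_bets[OF z J(1), of ?C ?D y s] by blast
    have value_of: "gain ?bs J s tt = \<alpha> * (1 - x) + \<beta> * (1 - y) + \<gamma> * (1 - z)"
      "gain ?bs J s tf = \<alpha> * (1 - x) - \<beta> * y - \<gamma> * z"
      "gain ?bs J s ft = - \<alpha> * x + \<beta> * (1 - y) - \<gamma> * z"
      "gain ?bs J s ff = - \<alpha> * x - \<beta> * y - \<gamma> * z"
      "gain ?bs J s tv = \<alpha> * (1 - x) + \<gamma> * (1 - z)"
      "gain ?bs J s vt = \<beta> * (1 - y) + \<gamma> * (1 - z)"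
      unfolding gain using atoms by (simp_all add: cond_value_def sobocinski_conj_def)
    have off: "called_off (?bs ! 0) = - H" "called_off (?bs ! 1) = - K"
      "called_off (?bs ! 2) = - H \<inter> - K" "called_off (?bs ! 3) = (- A \<inter> H) \<union> (- H \<inter> - K)"
      by (auto simp: cond_bet_def iter_bet_def void_def sobocinski_conj_def
          iter_called_off_Cond[OF \<open>x \<noteq> 0\<close>])
    from J obtain j where j: "j \<in> J" "j = 0 \<or> j = 1 \<or> j = 2 \<or> j = 3"
      by (auto simp: lessThan_4)
    have "w \<in> active ?bs J" if "w \<in> A \<inter> H \<inter> K" for w
      unfolding active_def using j off that by (intro UN_I[of j]) auto
    then have tt: "gain ?bs J s tt < 0" and tf: "gain ?bs J s tf < 0"
      using atoms neg by auto
    \<comment> \<open>The weights that realise the lower end for \<open>z\<close>.\<close>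
    define l where "l = max (x + y - 1) 0"
    have l: "0 \<le> l" "l \<le> x" "l \<le> y" "x + y - 1 \<le> l" "l \<le> z"
      using x y lower by (auto simp: l_def)
    have "l * gain ?bs J s tt + (x - l) * gain ?bs J s tf < 0"
    proof (cases "l = 0")
      case True
      then show ?thesis using tf x by (simp add: mult_pos_neg)
    next
      case False
      then have "l * gain ?bs J s tt < 0" using tt l by (simp add: mult_pos_neg)
      moreover have "(x - l) * gain ?bs J s tf \<le> 0"
        using tf l by (simp add: mult_nonneg_nonpos)
      ultimately show ?thesis by simp
    qed
    moreover have "(y - l) * gain ?bs J s ft \<le> 0" "(1 - x - y + l) * gain ?bs J s ff \<le> 0"
      using l nonpos by (simp_all add: mult_nonneg_nonpos)
    moreover have "l * gain ?bs J s tt + (x - l) * gain ?bs J s tf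
        + (y - l) * gain ?bs J s ft + (1 - x - y + l) * gain ?bs J s ff = \<gamma> * (l - z)"
      by (simp add: value_of algebra_simps)
    ultimately have "\<gamma> * (l - z) < 0" by linarith
    then have "0 < \<gamma>" "l < z"
      using l by (auto simp: mult_less_0_iff)
    have "\<not> (x = 1 \<and> y = 1)"
      using \<open>l < z\<close> upper by (auto simp: l_def)
    from \<gamma> \<open>0 < \<gamma>\<close> obtain i where i: "i \<in> J" "i = 2 \<or> i = 3" by auto
    have "w \<in> active ?bs J" if "w \<in> A \<inter> H \<inter> - K \<union> - H \<inter> K" for w
      unfolding active_def using i off that by (intro UN_I[of i]) auto
    then have tv: "gain ?bs J s tv < 0" and vt: "gain ?bs J s vt < 0"
      using atoms neg by auto
    \<comment> \<open>The weights that realise the upper end; leaving them unnormalised avoids dividing by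
      \<open>1 - x * y\<close>.\<close>
    have "x * (1 - y) * gain ?bs J s tv + y * (1 - x) * gain ?bs J s vt < 0"
    proof (cases "y = 1")
      case True
      then show ?thesis using vt x \<open>\<not> (x = 1 \<and> y = 1)\<close> by (simp add: mult_pos_neg)
    next
      case False
      then have "x * (1 - y) * gain ?bs J s tv < 0" using tv x y by (simp add: mult_pos_neg)
      moreover have "y * (1 - x) * gain ?bs J s vt \<le> 0"
        using vt x y by (simp add: mult_nonneg_nonpos)
      ultimately show ?thesis by simp
    qed
    moreover have "(1 - x) * (1 - y) * gain ?bs J s ff \<le> 0"
      using x y nonpos by (simp add: mult_nonneg_nonpos)
    moreover have "x * (1 - y) * gain ?bs J s tv + y * (1 - x) * gain ?bs J s vt
        + (1 - x) * (1 - y) * gain ?bs J s ff = \<gamma> * (x + y - 2 * x * y - z * (1 - x * y))"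
      by (simp add: value_of algebra_simps)
    moreover have "0 \<le> \<gamma> * (x + y - 2 * x * y - z * (1 - x * y))"
      using \<open>0 < \<gamma>\<close> upper by simp
    ultimately show False by linarith
  qed
  then show ?thesis
    using coherent_iff_no_sure_loss[of ?bs, OF finite possible] unfolding len by blast
qed

theorem theorem18:
  fixes A B H K :: "'w set" and x y \<mu> :: real
  assumes "logically_independent A B H K"
    and "coherent [cond_bet (Cond A H) x, cond_bet (Cond B K) y]"
    and "x \<noteq> 0"
  shows "coherent_extension (Cond A H) (Cond B K) x y \<mu> \<longleftrightarrow>
     \<mu> \<in> {max ((x + y - 1) / x) 0 ..
           (if (x, y) \<noteq> (1, 1) then (x + y - 2 * x * y) / (x * (1 - x * y)) else 1)}"
proof -
  let ?bs = "[cond_bet (Cond A H) x, cond_bet (Cond B K) y]"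
  have "A \<inter> B \<inter> H \<inter> K \<noteq> {}"
    using assms(1) by (auto simp: logically_independent_def)
  then have "called_off b \<noteq> UNIV" if "b \<in> set ?bs" for b
    using that by (auto simp: cond_bet_def void_def)
  moreover have "finite (range (quantity b))" if "b \<in> set ?bs" for b
    using that by (auto simp: cond_bet_def finite_range_cond_value)
  ultimately have "0 \<le> p \<and> p \<le> 1" if "cond_bet E p \<in> set ?bs" for E p
    using coherent_cond_bet_price[OF assms(2)] that by blast
  then have x: "0 < x" "x \<le> 1" and y: "0 \<le> y" "y \<le> 1"
    using \<open>x \<noteq> 0\<close> by (force simp: less_le)+
  have "coherent_extension (Cond A H) (Cond B K) x y \<mu> \<longleftrightarrow> max (x + y - 1) 0 \<le> x * \<mu> \<and>
      x * \<mu> \<le> 1 \<and> x * \<mu> * (1 - x * y) \<le> x + y - 2 * x * y"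
    unfolding coherent_extension_def
    using coherent_iter_price_bounds[OF assms(1,3)] coherent_iter_betsI[OF assms(1) x y] by blast
  also have "\<dots> \<longleftrightarrow> \<mu> \<in> {max ((x + y - 1) / x) 0 ..
           (if (x, y) \<noteq> (1, 1) then (x + y - 2 * x * y) / (x * (1 - x * y)) else 1)}"
  proof -
    have low: "max (x + y - 1) 0 \<le> x * \<mu> \<longleftrightarrow> max ((x + y - 1) / x) 0 \<le> \<mu>"
      using x by (simp add: pos_divide_le_eq mult.commute zero_le_mult_iff)
    show ?thesis
    proof (cases "x = 1 \<and> y = 1")
      case True
      then show ?thesis using low by auto
    next
      case False
      have "x * y < 1"
        using False x y by (smt (verit) mult_le_cancel_left1 mult_le_one mult_left_le)
      then have pos: "0 < 1 - x * y" "0 < x * (1 - x * y)"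
        using x by simp_all
      have up: "x * \<mu> * (1 - x * y) \<le> x + y - 2 * x * y
          \<longleftrightarrow> \<mu> \<le> (x + y - 2 * x * y) / (x * (1 - x * y))"
        using pos by (simp add: pos_le_divide_eq ac_simps)
      \<comment> \<open>The upper end for \<open>z\<close> is at most 1, so here \<open>x * \<mu> \<le> 1\<close> follows from the other bound; it is the
        effective upper bound only for \<open>x = y = 1\<close>, where that bound reads \<open>0 \<le> 0\<close>.\<close>
      have "0 \<le> (1 - x) * (1 - y)"
        using x y by simp
      then have "x + y - 2 * x * y \<le> 1 * (1 - x * y)"
        by (simp add: algebra_simps)
      then have "x * \<mu> \<le> 1" if "x * \<mu> * (1 - x * y) \<le> x + y - 2 * x * y"
        using that pos(1) by (meson mult_le_cancel_right_pos order_trans)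
      then show ?thesis
        using False low up by auto
    qed
  qed
  finally show ?thesis .
qed

end
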